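(* (Global Linear Convergence Rate.) Let $\{\mathbf{X}^t\}_{t=0}^\infty$ be generated by the algorithm NLOA (described in the context) and let the assumption with constants $\sigma,L$ stated in the context hold. Then the sequence $\mathbf{X}^t$ converges to the global optimal solution $\mathbf{X}^*$ of $\min_{\mathbf{X}\succ\mathbf{0}}f(\mathbf{X})+p(\mathbf{X})$ linearly, i.e. (in the R-linear sense) there exist constants $C>0$ and $\rho\in(0,1)$ such that $\|\mathbf{X}^t-\mathbf{X}^*\|_{\mathrm{F}}\le C\rho^t$ for all $t$.
   Context: Let $\mathbf{\Sigma}\in\mathbb{R}^{n\times n}$ be symmetric and $f(\mathbf{X})=\langle\mathbf{\Sigma},\mathbf{X}\rangle-\log\det(\mathbf{X})$ on symmetric positive definite matrices ($\mathbf{X}\succ\mathbf{0}$). Let $S$ be a set of matrix positions (a support set, symmetric under transposition), $Z$ its complement in the set of all $n^2$ positions, $\Omega=\{\mathbf{X}:\mathbf{X}_Z=\mathbf{0}\}$, and $p=I_\Omega$ the indicator function ($0$ on $\Omega$, $+\infty$ elsewhere). The convex problem is $\min_{\mathbf{X}\succ\mathbf{0}}f(\mathbf{X})+p(\mathbf{X})$; $\mathbf{X}^*$ denotes its global optimal solution. Notation: $g(\mathbf{X})=\mathbf{\Sigma}-\mathbf{X}^{-1}$ and $h(\mathbf{X})=\mathbf{X}^{-1}\otimes\mathbf{X}^{-1}$ are the gradient and Hessian of $f$; $\mathbf{G}^t=g(\mathbf{X}^t)$, $\mathbf{H}^t=h(\mathbf{X}^t)$. $\mathrm{vec}$ stacks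 columns. The Newton direction is the exact minimizer $$\mathbf{D}^t=d(\mathbf{X}^t)=\arg\min_{\mathbf{\Delta}}\ f(\mathbf{X}^t)+\langle\mathbf{\Delta},\mathbf{G}^t\rangle+\tfrac12\mathrm{vec}(\mathbf{\Delta})^T\mathbf{H}^t\mathrm{vec}(\mathbf{\Delta})+p(\mathbf{X}^t+\mathbf{\Delta}).$$ Algorithm NLOA: start from $\mathbf{X}^0\succ\mathbf{0}$ with $\mathbf{X}^0_Z=\mathbf{0}$ and iterate $\mathbf{X}^{t+1}=\mathbf{X}^t+\alpha^t\mathbf{D}^t$, $t=0,1,2,\dots$, where with fixed constants $0<\beta<1$ and $0<\omega<0.5$ the step size $\alpha^t$ is $\beta^m$ for the smallest integer $m\ge0$ such that $\mathbf{X}^t+\alpha^t\mathbf{D}^t\succ\mathbf{0}$ and $f(\mathbf{X}^t+\alpha^t\mathbf{D}^t)\le f(\mathbf{X}^t)+\alpha^t\omega\langle\mathbf{G}^t,\mathbf{D}^t\rangle$. Assumption: $f$ is strongly convex with modulus $\sigma>0$ and has Lipschitz continuous gradient with constant $L$ for all $\mathbf{X}^t$, $t=0,1,2,\dots$; equivalently all eigenvalues of $\mathbf{H}^t$ lie in $[\sigma,L]$, i.e. all eigenvalues of $\mathbf{X}^t$ lie in $[1/\sqrt{L},1/\sqrt{\sigma}]$, for every $t$. *)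

theory Defs
  imports "HOL-Analysis.Analysis"
begin

definition pos_def :: "real^'n^'n \<Rightarrow> bool" where
  "pos_def A \<longleftrightarrow> transpose A = A \<and> (\<forall>x. x \<noteq> 0 \<longrightarrow> x \<bullet> (A *v x) > 0)"

definition eigenvalue :: "real^'n^'n \<Rightarrow> real \<Rightarrow> bool" where
  "eigenvalue A ev \<longleftrightarrow> (\<exists>v. v \<noteq> 0 \<and> A *v v = ev *\<^sub>R v)"

text \<open>Rows and columns of a Kronecker product are indexed by pairs (block index, index inside
  the block). Stacking columns therefore puts the entry in row i and column j at index (j, i).\<close>

definition kronecker :: "real^'b^'a \<Rightarrow> real^'d^'c \<Rightarrow> real^('b \<times> 'd)^('a \<times> 'c)" where
  "kronecker A B = (\<chi> r c. A $ fst r $ fst c * B $ snd r $ snd c)"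

definition vec_cols :: "real^'n^'m \<Rightarrow> real^('n \<times> 'm)" where
  "vec_cols A = (\<chi> k. A $ snd k $ fst k)"

text \<open>On the type of square real matrices the library's inner product \<open>\<bullet>\<close> is the trace inner
  product and the library's \<open>norm\<close> is the Frobenius norm.\<close>

definition obj :: "real^'n^'n \<Rightarrow> real^'n^'n \<Rightarrow> real" where
  "obj Sig X = Sig \<bullet> X - ln (det X)"

definition grad :: "real^'n^'n \<Rightarrow> real^'n^'n \<Rightarrow> real^'n^'n" where
  "grad Sig X = Sig - matrix_inv X"

definition hess :: "real^'n^'n \<Rightarrow> real^('n \<times> 'n)^('n \<times> 'n)" where
  "hess X = kronecker (matrix_inv X) (matrix_inv X)"

definition Omega :: "('n \<times> 'n) set \<Rightarrow> (real^'n^'n) set" where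
  "Omega S = {X. \<forall>(i, j) \<in> - S. X $ i $ j = 0}"

definition pen :: "('n \<times> 'n) set \<Rightarrow> real^'n^'n \<Rightarrow> ereal" where
  "pen S X = (if X \<in> Omega S then 0 else \<infinity>)"

definition global_opt :: "real^'n^'n \<Rightarrow> ('n \<times> 'n) set \<Rightarrow> real^'n^'n \<Rightarrow> bool" where
  "global_opt Sig S X \<longleftrightarrow> is_arg_min (\<lambda>Y. ereal (obj Sig Y) + pen S Y) pos_def X"

definition newton_model ::
  "real^'n^'n \<Rightarrow> ('n \<times> 'n) set \<Rightarrow> real^'n^'n \<Rightarrow> real^'n^'n \<Rightarrow> ereal" where
  "newton_model Sig S X \<Delta> =
     ereal (obj Sig X + \<Delta> \<bullet> grad Sig X + 1/2 * (vec_cols \<Delta> \<bullet> (hess X *v vec_cols \<Delta>)))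
     + pen S (X + \<Delta>)"

definition newton_dir :: "real^'n^'n \<Rightarrow> ('n \<times> 'n) set \<Rightarrow> real^'n^'n \<Rightarrow> real^'n^'n" where
  "newton_dir Sig S X = (ARG_MIN (newton_model Sig S X) \<Delta>. True)"

definition step_size ::
  "real^'n^'n \<Rightarrow> real \<Rightarrow> real \<Rightarrow> real^'n^'n \<Rightarrow> real^'n^'n \<Rightarrow> real" where
  "step_size Sig \<beta> \<omega> X D = \<beta> ^ (LEAST m.
     pos_def (X + \<beta> ^ m *\<^sub>R D) \<and>
     obj Sig (X + \<beta> ^ m *\<^sub>R D) \<le> obj Sig X + \<beta> ^ m * \<omega> * (grad Sig X \<bullet> D))"

definition NLOA_sequence ::
  "real^'n^'n \<Rightarrow> ('n \<times> 'n) set \<Rightarrow> real \<Rightarrow> real \<Rightarrow> (nat \<Rightarrow> real^'n^'n) \<Rightarrow> bool" where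
  "NLOA_sequence Sig S \<beta> \<omega> X \<longleftrightarrow>
     pos_def (X 0) \<and> X 0 \<in> Omega S \<and>
     (\<forall>t. X (Suc t) = X t +
        step_size Sig \<beta> \<omega> (X t) (newton_dir Sig S (X t)) *\<^sub>R newton_dir Sig S (X t))"

end

theory Submission imports Defs begin

text \<open>For positive definite \<open>X\<close> the Hessian of the objective \<open>f\<close> defines a local inner product
  \<open>hform X A B = A \<bullet> (matrix_inv X ** B ** matrix_inv X)\<close>. Diagonalizing a symmetric \<open>E\<close> relative to
  \<open>X\<close> (\<open>simultaneous_diagonalization\<close>) gives relative eigenvalues \<open>e i\<close> with
  \<open>hform X E E = (\<Sum>i. (e i)\<^sup>2)\<close> and the exact formula
  \<open>f (X + E) = f X + grad X \<bullet> E + (\<Sum>i. e i - ln (1 + e i))\<close> (\<open>objective_expansion\<close>). Convexity and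
  smoothness of the objective thus reduce to inequalities for the scalar function \<open>u - ln (1 + u)\<close>.
  The spectral assumption makes the local norms at all iterates uniformly equivalent to the Frobenius
  norm, and it keeps the iterates in a ball because \<open>hform X X X\<close> is the dimension.

  Let \<open>D\<close> be the Newton direction at an iterate \<open>X\<close> and \<open>q = hform X D D\<close> its squared decrement. The
  Newton equation \<open>hform X D E = - (grad X \<bullet> E)\<close> holds for all admissible \<open>E\<close>. It gives an upper bound
  for \<open>q\<close>, hence a lower bound for the step size, and so each step lowers the objective by at least
  \<open>\<kappa> q\<close> for a fixed \<open>\<kappa>\<close> (\<open>iteration\<close>). If \<open>Y\<close> is feasible and no worse than any iterate, the expansion
  from \<open>X\<close> to \<open>Y\<close> together with the Cauchy-Schwarz inequality shows that \<open>q\<close> dominates both the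
  gap \<open>f X - f Y\<close> and the squared distance from \<open>X\<close> to \<open>Y\<close> (\<open>error_bound\<close>). Hence the gap contracts by a
  fixed factor, and the squared distance, being dominated by \<open>q\<close> and therefore by the gap, decays
  geometrically as well (\<open>linear_convergence\<close>).

  The objective need not have a minimizer in general; here the iterates provide one. Their values
  decrease to a finite limit, the decrements tend to \<open>0\<close>, and a cluster point is feasible and optimal
  (\<open>optimum_exists\<close>). Since the sequence converges to every optimum, there is only one.\<close>

section \<open>Simultaneous diagonalization\<close>

text \<open>This is the first-order optimality condition used twice below: a quadratic polynomial in
  \<open>s\<close> without constant term can only stay nonnegative near \<open>0\<close> if its linear coefficient
  vanishes.\<close>

lemma linear_coefficient_eq_zero:
  fixes a b :: real
  assumes "\<And>s. 0 \<le> a * s + b * s\<^sup>2"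
  shows "a = 0"
proof (rule ccontr)
  assume "a \<noteq> 0"
  define c where "c = \<bar>b\<bar> + 1"
  have c: "c > 0" "b < c" by (auto simp: c_def)
  have "0 \<le> a * (- a / c) + b * (- a / c)\<^sup>2" by (rule assms)
  also have "\<dots> = (a / c)\<^sup>2 * (b - c)"
    using c by (simp add: field_simps power2_eq_square)
  also have "\<dots> < 0"
    using c \<open>a \<noteq> 0\<close> by (intro mult_pos_neg) auto
  finally show False by simp
qed

text \<open>The minimizer \<open>v\<close> of the generalized Rayleigh quotient \<open>(x \<bullet> f x) / (x \<bullet> g x)\<close> on a
  subspace exists by compactness of the unit sphere. Its stationarity condition is the eigenvalue
  equation \<open>f v = l g v\<close>, tested against vectors of the subspace only. Allowing a subspace makes
  the lemma serve both for extremal eigenvalues (whole space) and for the inductive step of the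
  diagonalization (complement of the eigenvectors already found).\<close>

lemma pencil_eigenvector:
  fixes f g :: "'a::euclidean_space \<Rightarrow> 'a"
  assumes f: "linear f" "\<And>x y. f x \<bullet> y = x \<bullet> f y"
    and g: "linear g" "\<And>x y. g x \<bullet> y = x \<bullet> g y" "\<And>x. x \<noteq> 0 \<Longrightarrow> 0 < x \<bullet> g x"
    and W: "subspace W" "u \<in> W" "u \<noteq> 0"
  obtains v l where "v \<in> W" "v \<bullet> g v = 1" "\<And>w. w \<in> W \<Longrightarrow> w \<bullet> f v = l * (w \<bullet> g v)"
    "\<And>w. w \<in> W \<Longrightarrow> l * (w \<bullet> g w) \<le> w \<bullet> f w"
proof -
  define R where "R x = (x \<bullet> f x) / (x \<bullet> g x)" for x
  have "compact (W \<inter> sphere 0 1)"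
    by (simp add: W(1) closed_subspace closed_Int_compact)
  moreover have "u /\<^sub>R norm u \<in> W \<inter> sphere 0 1"
    using W by (simp add: subspace_scale)
  then have "W \<inter> sphere 0 1 \<noteq> {}" by blast
  moreover have "continuous_on (W \<inter> sphere 0 1) R"
    unfolding R_def using g(3)
    by (intro continuous_intros linear_continuous_on[OF linear_conv_bounded_linear[THEN iffD1]] f g)
      (metis IntD2 dist_0_norm less_irrefl mem_sphere norm_zero zero_neq_one)
  ultimately have "\<exists>z\<in>W \<inter> sphere 0 1. \<forall>x\<in>W \<inter> sphere 0 1. R z \<le> R x"
    by (intro continuous_attains_inf)
  then obtain z where z: "z \<in> W" "norm z = 1"
    and z_min: "\<And>x. x \<in> W \<inter> sphere 0 1 \<Longrightarrow> R z \<le> R x"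
    by auto
  have gz: "0 < z \<bullet> g z" using z by (intro g(3)) auto
  have min: "R z * (w \<bullet> g w) \<le> w \<bullet> f w" if "w \<in> W" for w
  proof (cases "w = 0")
    case True then show ?thesis using g(1) by (simp add: linear_0)
  next
    case False
    have "R z \<le> R (w /\<^sub>R norm w)"
      using that False W(1) by (intro z_min) (simp add: subspace_scale)
    also have "\<dots> = R w"
      using False f(1) g(1) by (simp add: R_def linear_scale)
    finally show ?thesis
      using g(3)[OF False] by (simp add: R_def pos_le_divide_eq)
  qed
  define v where "v = z /\<^sub>R sqrt (z \<bullet> g z)"
  have v: "v \<in> W" "v \<bullet> g v = 1"
    using z gz W(1) g(1) by (auto simp: v_def subspace_scale linear_scale field_simps)
  have fv: "v \<bullet> f v = R z"
    using gz f(1) by (simp add: v_def R_def linear_scale field_simps)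
  have "w \<bullet> f v = R z * (w \<bullet> g v)" if w: "w \<in> W" for w
  proof -
    have "0 \<le> 2 * (w \<bullet> f v - R z * (w \<bullet> g v)) * s + (w \<bullet> f w - R z * (w \<bullet> g w)) * s\<^sup>2" for s
    proof -
      have "R z * ((v + s *\<^sub>R w) \<bullet> g (v + s *\<^sub>R w)) \<le> (v + s *\<^sub>R w) \<bullet> f (v + s *\<^sub>R w)"
        using v w W(1) by (intro min) (simp add: subspace_add subspace_scale)
      moreover have "v \<bullet> f w = w \<bullet> f v" "v \<bullet> g w = w \<bullet> g v"
        using f(2)[of v w] g(2)[of v w] by (simp_all add: inner_commute)
      ultimately show ?thesis
        using f(1) g(1) v fv
        by (simp add: linear_add linear_scale inner_add_left inner_add_right
            algebra_simps power2_eq_square)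
    qed
    then have "2 * (w \<bullet> f v - R z * (w \<bullet> g v)) = 0"
      by (rule linear_coefficient_eq_zero)
    then show ?thesis by simp
  qed
  with v min show ?thesis by (intro that)
qed

lemma symmetric_matrix_inner:
  fixes A :: "real^'n^'n"
  assumes "transpose A = A"
  shows "(A *v x) \<bullet> y = x \<bullet> (A *v y)"
  by (metis assms dot_lmul_matrix vector_transpose_matrix)

text \<open>The extreme values of the Rayleigh quotient are themselves eigenvalues, so a bound on the
  eigenvalues bounds the quadratic form. The upper bound is the lower one for \<open>- A\<close>.\<close>

lemma rayleigh_bounds:
  fixes A :: "real^'n^'n"
  assumes A: "transpose A = A" and ev: "\<And>l. eigenvalue A l \<Longrightarrow> a \<le> l \<and> l \<le> b"
  shows "a * (norm x)\<^sup>2 \<le> x \<bullet> (A *v x)" "x \<bullet> (A *v x) \<le> b * (norm x)\<^sup>2"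
proof -
  obtain u :: "real^'n" where u: "u \<noteq> 0"
    using zero_neq_one by blast
  have eq: "l = m" if "\<And>w :: real^'n. w \<bullet> l = w \<bullet> m" for l m
    using that by (metis vector_eq_ldot)
  obtain v l where v: "v \<bullet> v = 1" "\<And>w. w \<bullet> (A *v v) = l * (w \<bullet> v)"
    and l: "\<And>w. l * (w \<bullet> w) \<le> w \<bullet> (A *v w)"
    by (rule pencil_eigenvector[of "(*v) A" "\<lambda>x. x" UNIV u])
      (use u symmetric_matrix_inner[OF A] in \<open>auto simp: linear_id[unfolded id_def]\<close>)
  have "eigenvalue A l"
    unfolding eigenvalue_def using v by (intro exI[of _ v] conjI eq) auto
  with ev have "a * (x \<bullet> x) \<le> l * (x \<bullet> x)" by (intro mult_right_mono) auto
  with l[of x] show "a * (norm x)\<^sup>2 \<le> x \<bullet> (A *v x)" by (simp add: dot_square_norm)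
  obtain v l where v: "v \<bullet> v = 1" "\<And>w. w \<bullet> (- (A *v v)) = l * (w \<bullet> v)"
    and l: "\<And>w. l * (w \<bullet> w) \<le> w \<bullet> (- (A *v w))"
    by (rule pencil_eigenvector[of "\<lambda>x. - (A *v x)" "\<lambda>x. x" UNIV u])
      (use u symmetric_matrix_inner[OF A] in \<open>auto simp: linear_compose_neg linear_id[unfolded id_def]\<close>)
  have "eigenvalue A (- l)"
    unfolding eigenvalue_def using v by (intro exI[of _ v] conjI eq) (auto simp: minus_equation_iff)
  with ev have "- l * (x \<bullet> x) \<le> b * (x \<bullet> x)" by (intro mult_right_mono) auto
  with l[of x] show "x \<bullet> (A *v x) \<le> b * (norm x)\<^sup>2" by (simp add: dot_square_norm)
qed

definition diag_mat :: "('n \<Rightarrow> real) \<Rightarrow> real^'n^'n" where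
  "diag_mat e = (\<chi> i j. if i = j then e i else 0)"

text \<open>Induction on the index set: as long as fewer vectors than the dimension have been found, their
  \<open>A\<close>-orthogonal complement \<open>W\<close> contains a nonzero vector, and the preceding lemma yields an
  eigenvector of the pencil \<open>(E, A)\<close> relative to \<open>W\<close>. It is an eigenvector on the whole space
  because \<open>E\<close> maps the old vectors to multiples of \<open>A *v v i\<close>, which are orthogonal to \<open>W\<close>.\<close>

lemma simultaneous_orthonormal_family:
  fixes A E :: "real^'n^'n" and I :: "'n set"
  assumes A: "pos_def A" and E: "transpose E = E"
  shows "\<exists>v e. \<forall>i\<in>I. E *v v i = e i *\<^sub>R (A *v v i) \<and>
    (\<forall>j\<in>I. v i \<bullet> (A *v v j) = (if i = j then 1 else 0))"
proof -
  have symA: "(A *v x) \<bullet> y = x \<bullet> (A *v y)" for x y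
    using A symmetric_matrix_inner unfolding pos_def_def by blast
  have "finite I" by simp
  then show ?thesis
  proof (induction I rule: finite_induct)
    case empty show ?case by simp
  next
    case (insert k I)
    then obtain v e where ve: "\<And>i. i \<in> I \<Longrightarrow> E *v v i = e i *\<^sub>R (A *v v i)"
      "\<And>i j. i \<in> I \<Longrightarrow> j \<in> I \<Longrightarrow> v i \<bullet> (A *v v j) = (if i = j then 1 else 0)"
      by blast
    define W where "W = {x. \<forall>i\<in>I. (A *v v i) \<bullet> x = 0}"
    have W: "subspace W"
      by (auto simp: W_def subspace_def inner_add_right)
    have "dim ((\<lambda>i. A *v v i) ` I) \<le> card I"
      by (rule order_trans[OF dim_le_card' card_image_le]) auto
    also have "card I < card (insert k I)" using insert by simp
    also have "\<dots> \<le> DIM(real^'n)" by (simp add: card_mono)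
    finally obtain u where "u \<noteq> 0" "\<And>y. y \<in> span ((\<lambda>i. A *v v i) ` I) \<Longrightarrow> orthogonal u y"
      by (rule orthogonal_to_subspace_exists) blast
    then have u: "u \<in> W" "u \<noteq> 0"
      by (auto simp: W_def orthogonal_def span_base inner_commute[of "A *v _" u])
    obtain x l where x: "x \<in> W" "x \<bullet> (A *v x) = 1"
      and xl: "\<And>w. w \<in> W \<Longrightarrow> w \<bullet> (E *v x) = l * (w \<bullet> (A *v x))"
      by (rule pencil_eigenvector[of "(*v) E" "(*v) A" W u])
        (use u W A symA symmetric_matrix_inner[OF E] in \<open>auto simp: pos_def_def\<close>)
    have vx: "v i \<bullet> (A *v x) = 0" if "i \<in> I" for i
      using x(1) that symA by (simp add: W_def)
    have xv: "x \<bullet> (A *v v i) = 0" if "i \<in> I" for i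
      using x(1) that by (simp add: W_def inner_commute)
    have "E *v x = l *\<^sub>R (A *v x)"
    proof (rule vector_eq_ldot[THEN iffD1], rule allI)
      fix y
      (* w is the A-orthogonal projection of the test vector y onto W *)
      define w where "w = y - (\<Sum>i\<in>I. ((A *v v i) \<bullet> y) *\<^sub>R v i)"
      have "(A *v v j) \<bullet> w = 0" if j: "j \<in> I" for j
      proof -
        have "(A *v v j) \<bullet> (\<Sum>i\<in>I. ((A *v v i) \<bullet> y) *\<^sub>R v i)
            = (\<Sum>i\<in>I. if i = j then (A *v v i) \<bullet> y else 0)"
          unfolding inner_sum_right using ve(2) j
          by (intro sum.cong) (auto simp: symA)
        also have "\<dots> = (A *v v j) \<bullet> y" using j by (simp add: insert.hyps)
        finally show ?thesis by (simp add: w_def inner_diff_right)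
      qed
      then have "w \<in> W" by (simp add: W_def)
      moreover have "v i \<bullet> (E *v x) = 0" if "i \<in> I" for i
        using symmetric_matrix_inner[OF E, of "v i" x] ve(1) that x(1) by (simp add: W_def)
      moreover have y: "y = w + (\<Sum>i\<in>I. ((A *v v i) \<bullet> y) *\<^sub>R v i)" by (simp add: w_def)
      ultimately have "w \<bullet> (E *v x) = l * (w \<bullet> (A *v x))" "\<And>i. i \<in> I \<Longrightarrow> v i \<bullet> (E *v x) = 0"
        using xl by auto
      then show "y \<bullet> (E *v x) = y \<bullet> (l *\<^sub>R (A *v x))"
        using vx by (subst (1 2) y) (simp add: inner_add_left inner_sum_left)
    qed
    then show ?case
      using ve vx xv x insert.hyps
      by (intro exI[of _ "v(k := x)"] exI[of _ "e(k := l)"]) auto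
  qed
qed

text \<open>The columns of \<open>P\<close> are the vectors of a full family.\<close>

lemma simultaneous_diagonalization:
  fixes A E :: "real^'n^'n"
  assumes A: "pos_def A" and E: "transpose E = E"
  obtains P :: "real^'n^'n" and e where "transpose P ** A ** P = mat 1" "transpose P ** E ** P = diag_mat e"
proof -
  obtain v :: "'n \<Rightarrow> real^'n" and e where "\<forall>i\<in>UNIV. E *v v i = e i *\<^sub>R (A *v v i) \<and>
      (\<forall>j\<in>UNIV. v i \<bullet> (A *v v j) = (if i = j then 1 else 0))"
    using simultaneous_orthonormal_family[OF A E, of UNIV] by blast
  then have v: "\<And>i. E *v v i = e i *\<^sub>R (A *v v i)"
    "\<And>i j. v i \<bullet> (A *v v j) = (if i = j then 1 else 0)" by simp_all
  define P where "P = (\<chi> i j. v j $ i)"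
  have P: "(transpose P ** M ** P) $ i $ j = v i \<bullet> (M *v v j)" for M i j
    by (simp add: P_def matrix_matrix_mult_def transpose_def inner_vec_def matrix_vector_mult_def
        sum_distrib_left sum_distrib_right mult.assoc)
      (rule sum.swap)
  show ?thesis
  proof
    show "transpose P ** A ** P = mat 1"
      by (simp add: vec_eq_iff P v mat_def)
    show "transpose P ** E ** P = diag_mat e"
      by (simp add: vec_eq_iff P v diag_mat_def)
  qed
qed

section \<open>Congruence and the local inner product\<close>

lemma matrix_inv_eqI:
  fixes A B :: "real^'n^'n"
  assumes "A ** B = mat 1"
  shows "matrix_inv A = B"
proof -
  have B: "B ** A = mat 1" using assms by (rule matrix_left_right_inverse1)
  then have "A ** matrix_inv A = mat 1"
    using assms someI_ex[of "\<lambda>A'. A ** A' = mat 1 \<and> A' ** A = mat 1"]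
    unfolding matrix_inv_def by blast
  then show ?thesis
    by (metis B matrix_mul_assoc matrix_mul_lid matrix_mul_rid)
qed

lemma inner_eq_trace: "A \<bullet> B = trace (transpose A ** B)" for A B :: "real^'n^'m"
  by (simp add: inner_vec_def trace_def matrix_matrix_mult_def transpose_def) (rule sum.swap)

lemma inner_transpose: "transpose A \<bullet> transpose B = A \<bullet> B" for A B :: "real^'n^'m"
  by (simp add: inner_vec_def transpose_def) (rule sum.swap)

lemma transpose_add: "transpose (A + B) = transpose A + transpose B"
  by (simp add: transpose_def vec_eq_iff)

definition congr :: "real^'n^'n \<Rightarrow> real^'n^'n \<Rightarrow> real^'n^'n" where
  "congr P A = transpose P ** A ** P"

lemma linear_congr: "linear (congr P)"
proof (rule linearI)
  have "(A + B) ** P = A ** P + B ** P" for A B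
    by (simp add: matrix_matrix_mult_def vec_eq_iff distrib_right sum.distrib)
  then show "congr P (A + B) = congr P A + congr P B" for A B
    by (simp add: congr_def matrix_add_ldistrib)
  show "congr P (s *\<^sub>R A) = s *\<^sub>R congr P A" for s A
    by (simp add: congr_def matrix_scalar_ac scalar_matrix_assoc)
qed

lemma transpose_congr: "transpose (congr P A) = congr P (transpose A)"
  by (simp add: congr_def matrix_transpose_mul transpose_transpose matrix_mul_assoc)

lemma congr_congr: "congr Q (congr P A) = congr (P ** Q) A"
  by (simp add: congr_def matrix_transpose_mul matrix_mul_assoc)

lemma congr_mat_1: "congr (mat 1) A = A"
  by (simp add: congr_def transpose_mat)

lemma pos_def_congr:
  assumes A: "pos_def A" and PQ: "P ** Q = mat 1"
  shows "pos_def (congr P A)"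
proof -
  have "0 < x \<bullet> (congr P A *v x)" if "x \<noteq> 0" for x
  proof -
    have "Q *v (P *v x) = x"
      using matrix_left_right_inverse1[OF PQ] by (simp add: matrix_vector_mul_assoc)
    then have "P *v x \<noteq> 0" using that by auto
    then have "0 < (P *v x) \<bullet> (A *v (P *v x))" using A by (simp add: pos_def_def)
    also have "\<dots> = x \<bullet> (transpose P *v (A *v (P *v x)))"
      by (metis dot_lmul_matrix inner_commute vector_transpose_matrix)
    finally show ?thesis by (simp add: congr_def matrix_vector_mul_assoc matrix_mul_assoc)
  qed
  then show ?thesis using A by (simp add: pos_def_def transpose_congr)
qed

lemma diag_mat_mult_vec: "(diag_mat d *v x) $ i = d i * x $ i"
proof -
  have "(\<Sum>j\<in>UNIV. (if i = j then d i else 0) * x $ j) = (\<Sum>j\<in>UNIV. if i = j then d i * x $ j else 0)"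
    by (intro sum.cong) auto
  then show ?thesis by (simp add: diag_mat_def matrix_vector_mult_def)
qed

lemma pos_def_diag_mat: "pos_def (diag_mat d) \<longleftrightarrow> (\<forall>i. 0 < d i)"
proof
  assume d: "pos_def (diag_mat d)"
  show "\<forall>i. 0 < d i"
  proof
    fix i
    have "0 < axis i 1 \<bullet> (diag_mat d *v axis i 1)"
      using d by (simp add: pos_def_def axis_eq_0_iff)
    then show "0 < d i" by (simp add: inner_axis' diag_mat_mult_vec)
  qed
next
  assume d: "\<forall>i. 0 < d i"
  have "0 < x \<bullet> (diag_mat d *v x)" if x: "x \<noteq> 0" for x
  proof -
    obtain k where "x $ k \<noteq> 0" using x by (auto simp: vec_eq_iff)
    then have "0 < (\<Sum>i\<in>UNIV. d i * (x $ i)\<^sup>2)"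
      using d by (intro sum_pos2[of _ k]) (auto simp: less_imp_le)
    then show ?thesis
      by (simp add: inner_vec_def diag_mat_mult_vec power2_eq_square mult.left_commute)
  qed
  moreover have "transpose (diag_mat d) = diag_mat d"
    by (auto simp: diag_mat_def transpose_def vec_eq_iff)
  ultimately show "pos_def (diag_mat d)" by (simp add: pos_def_def)
qed

lemma trace_diag_mat: "trace (diag_mat d) = (\<Sum>i\<in>UNIV. d i)"
  by (simp add: trace_def diag_mat_def)

lemma inner_diag_mat: "diag_mat d \<bullet> diag_mat e = (\<Sum>i\<in>UNIV. d i * e i)"
proof -
  have "(\<Sum>j\<in>UNIV. (if i = j then d i else 0) * (if i = j then e i else 0)) = d i * e i" for i :: 'a
    by (subst sum.cong[OF refl, of _ _ "\<lambda>j. if i = j then d i * e i else 0"]) auto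
  then show ?thesis by (simp add: inner_vec_def diag_mat_def)
qed

lemma det_diag_mat: "det (diag_mat d) = (\<Prod>i\<in>UNIV. d i)"
  by (subst det_diagonal) (auto simp: diag_mat_def)

text \<open>The Hessian of the objective at \<open>X\<close> as a bilinear form on matrices. It serves as an inner
  product attached to the point \<open>X\<close>.\<close>

definition hform :: "real^'n^'n \<Rightarrow> real^'n^'n \<Rightarrow> real^'n^'n \<Rightarrow> real" where
  "hform X A B = A \<bullet> (matrix_inv X ** B ** matrix_inv X)"

text \<open>The congruence that turns \<open>X\<close> into the identity is an isometry from the local inner product at
  \<open>X\<close> to the Frobenius inner product, and it can be chosen so that a given symmetric \<open>E\<close>
  becomes diagonal. The diagonal entries of \<open>congr P E\<close> are the eigenvalues of \<open>E\<close> relative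
  to \<open>X\<close>. All properties of the form below are read off in these coordinates.\<close>

lemma hessian_coordinates:
  fixes X E :: "real^'n^'n"
  assumes X: "pos_def X" and E: "transpose E = E"
  obtains P Q :: "real^'n^'n" and e where "P ** Q = mat 1" "matrix_inv X = P ** transpose P"
    "congr P X = mat 1" "congr P E = diag_mat e"
    "\<And>A B. hform X A B = congr P A \<bullet> congr P B"
proof -
  obtain P e where P: "congr P X = mat 1" "congr P E = diag_mat e"
    using simultaneous_diagonalization[OF X E] unfolding congr_def by blast
  then have PQ: "P ** (transpose P ** X) = mat 1"
    unfolding congr_def by (simp add: matrix_left_right_inverse)
  then have "(P ** transpose P) ** X = mat 1" by (simp add: matrix_mul_assoc)
  then have inv: "matrix_inv X = P ** transpose P"
    by (intro matrix_inv_eqI) (simp add: matrix_left_right_inverse)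
  have "hform X A B = congr P A \<bullet> congr P B" for A B
  proof -
    have "congr P A \<bullet> congr P B
        = trace (transpose P ** (transpose A ** P ** transpose P ** B ** P))"
      by (simp add: inner_eq_trace congr_def matrix_transpose_mul transpose_transpose matrix_mul_assoc)
    also have "\<dots> = trace ((transpose A ** P ** transpose P ** B ** P) ** transpose P)"
      by (rule trace_mul_sym)
    finally show ?thesis by (simp add: hform_def inv inner_eq_trace matrix_mul_assoc)
  qed
  with PQ inv P show ?thesis by (intro that)
qed

lemma matrix_inv_pos_def:
  assumes "pos_def X"
  shows "X ** matrix_inv X = mat 1" "transpose (matrix_inv X) = matrix_inv X"
proof -
  have "transpose X = X" using assms by (simp add: pos_def_def)
  then obtain P Q where P: "P ** Q = mat 1" "matrix_inv X = P ** transpose P" "congr P X = mat 1"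
    using hessian_coordinates[OF assms] by metis
  then have "P ** (transpose P ** X) = mat 1"
    unfolding congr_def by (simp add: matrix_left_right_inverse)
  then have "(P ** transpose P) ** X = mat 1" by (simp add: matrix_mul_assoc)
  then show "X ** matrix_inv X = mat 1"
    by (simp add: P(2) matrix_left_right_inverse)
  show "transpose (matrix_inv X) = matrix_inv X"
    by (simp add: P(2) matrix_transpose_mul transpose_transpose)
qed

lemma hform_bilinear:
  assumes "pos_def X"
  shows "hform X (A + B) C = hform X A C + hform X B C" "hform X C (A + B) = hform X C A + hform X C B"
    "hform X (s *\<^sub>R A) C = s * hform X A C" "hform X C (s *\<^sub>R A) = s * hform X C A"
    "hform X A C = hform X C A"
proof -
  obtain P where "\<And>A B. hform X A B = congr P A \<bullet> congr P B"
    using hessian_coordinates[OF assms] assms unfolding pos_def_def by metis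
  then show "hform X (A + B) C = hform X A C + hform X B C"
    "hform X C (A + B) = hform X C A + hform X C B"
    "hform X (s *\<^sub>R A) C = s * hform X A C" "hform X C (s *\<^sub>R A) = s * hform X C A"
    "hform X A C = hform X C A"
    by (simp_all add: linear_add[OF linear_congr] linear_scale[OF linear_congr]
        inner_add_left inner_add_right inner_commute)
qed

lemma hform_nonneg: "pos_def X \<Longrightarrow> 0 \<le> hform X A A"
  using hessian_coordinates[of X "X"] by (metis inner_ge_zero pos_def_def)

lemma hform_Cauchy_Schwarz:
  assumes "pos_def X"
  shows "\<bar>hform X A B\<bar> \<le> sqrt (hform X A A) * sqrt (hform X B B)"
proof -
  obtain P where "\<And>A B. hform X A B = congr P A \<bullet> congr P B"
    using hessian_coordinates[OF assms] assms unfolding pos_def_def by metis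
  then show ?thesis
    using Cauchy_Schwarz_ineq2 by (simp flip: norm_eq_sqrt_inner)
qed

lemma hform_transpose:
  assumes "pos_def X"
  shows "hform X (transpose A) (transpose B) = hform X A B"
proof -
  obtain P where "\<And>A B. hform X A B = congr P A \<bullet> congr P B"
    using hessian_coordinates[OF assms] assms unfolding pos_def_def by metis
  then show ?thesis by (simp add: inner_transpose flip: transpose_congr)
qed

text \<open>The direction \<open>X\<close> itself has constant local length, and pairing with it gives the gradient of
  \<open>ln det\<close>. Together with the Cauchy-Schwarz inequality this controls the gradient and the size of
  the iterates without estimating a matrix inverse.\<close>

lemma hform_self:
  fixes X :: "real^'n^'n"
  assumes "pos_def X"
  shows "hform X X X = CARD('n)" "hform X X A = matrix_inv X \<bullet> A"
proof -
  have X: "transpose X = X" using assms by (simp add: pos_def_def)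
  have inv: "matrix_inv X ** X = mat 1"
    using matrix_inv_pos_def[OF assms] by (simp add: matrix_left_right_inverse)
  show "hform X X A = matrix_inv X \<bullet> A" for A
  proof -
    have "hform X X A = trace (X ** (matrix_inv X ** A ** matrix_inv X))"
      by (simp add: hform_def inner_eq_trace X)
    also have "\<dots> = trace (A ** matrix_inv X)"
      using matrix_inv_pos_def[OF assms] by (simp add: matrix_mul_assoc)
    also have "\<dots> = matrix_inv X \<bullet> A"
      using matrix_inv_pos_def[OF assms] trace_mul_sym[of A] by (simp add: inner_eq_trace)
    finally show ?thesis .
  qed
  from this[of X] show "hform X X X = CARD('n)"
    using matrix_inv_pos_def[OF assms] inv by (simp add: inner_eq_trace trace_I)
qed

lemma continuous_on_hform:
  assumes "pos_def X"
  shows "continuous_on A (\<lambda>D. hform X D D)"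
proof -
  obtain P where "\<And>A B. hform X A B = congr P A \<bullet> congr P B"
    using hessian_coordinates[OF assms] assms unfolding pos_def_def by metis
  moreover have "continuous_on A (congr P)"
    by (intro linear_continuous_on linear_conv_bounded_linear[THEN iffD1] linear_congr)
  ultimately show ?thesis by (simp add: continuous_on_inner)
qed

section \<open>Second-order bounds for the objective\<close>

text \<open>In the coordinates of \<open>hessian_coordinates\<close> the matrix \<open>X + E\<close> is the diagonal matrix with
  entries \<open>1 + e i\<close>, where the \<open>e i\<close> are the eigenvalues of \<open>E\<close> relative to \<open>X\<close>. Its
  determinant is therefore \<open>det X\<close> times the product of the \<open>1 + e i\<close>, and the remainder of the
  first-order expansion of the objective is an exact sum of values of the scalar function
  \<open>u - ln (1 + u)\<close>. No derivative of the determinant is involved.\<close>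

lemma objective_expansion:
  fixes X E :: "real^'n^'n"
  assumes X: "pos_def X" and E: "transpose E = E"
  obtains e :: "'n \<Rightarrow> real" where "hform X E E = (\<Sum>i\<in>UNIV. (e i)\<^sup>2)"
    "pos_def (X + E) \<longleftrightarrow> (\<forall>i. 0 < 1 + e i)"
    "\<And>Sig. pos_def (X + E) \<Longrightarrow>
      obj Sig (X + E) = obj Sig X + grad Sig X \<bullet> E + (\<Sum>i\<in>UNIV. e i - ln (1 + e i))"
proof -
  obtain P Q e where PQ: "P ** Q = mat 1" and inv: "matrix_inv X = P ** transpose P"
    and P: "congr P X = mat 1" "congr P E = diag_mat e"
    and h: "\<And>A B. hform X A B = congr P A \<bullet> congr P B"
    using hessian_coordinates[OF X E] by blast
  have sum: "congr P (X + E) = diag_mat (\<lambda>i. 1 + e i)"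
    unfolding linear_add[OF linear_congr] P by (auto simp: vec_eq_iff mat_def diag_mat_def)
  have pd: "pos_def (X + E) \<longleftrightarrow> (\<forall>i. 0 < 1 + e i)"
  proof
    assume "pos_def (X + E)"
    then have "pos_def (congr P (X + E))" using PQ by (rule pos_def_congr)
    then show "\<forall>i. 0 < 1 + e i" by (simp add: sum pos_def_diag_mat)
  next
    assume "\<forall>i. 0 < 1 + e i"
    then have "pos_def (congr P (X + E))" by (simp add: sum pos_def_diag_mat)
    then have "pos_def (congr Q (congr P (X + E)))"
      by (rule pos_def_congr[of _ _ P]) (use PQ in \<open>simp add: matrix_left_right_inverse\<close>)
    then show "pos_def (X + E)" by (simp add: congr_congr PQ congr_mat_1)
  qed
  have inner: "matrix_inv X \<bullet> E = (\<Sum>i\<in>UNIV. e i)"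
  proof -
    have "matrix_inv X \<bullet> E = trace (P ** (transpose P ** E))"
      by (simp add: inner_eq_trace inv matrix_transpose_mul transpose_transpose matrix_mul_assoc)
    also have "\<dots> = trace (congr P E)" unfolding congr_def by (rule trace_mul_sym)
    finally show ?thesis by (simp add: P trace_diag_mat)
  qed
  have det: "(det P)\<^sup>2 * det A = det (congr P A)" for A
    by (simp add: congr_def det_mul power2_eq_square)
  have detX: "(det P)\<^sup>2 * det X = 1" unfolding det P by simp
  then have P0: "det P \<noteq> 0" by auto
  have "obj Sig (X + E) = obj Sig X + grad Sig X \<bullet> E + (\<Sum>i\<in>UNIV. e i - ln (1 + e i))"
    if "pos_def (X + E)" for Sig
  proof -
    have e: "\<forall>i. 0 < 1 + e i" using that pd by simp
    have "det (X + E) = det X * (\<Prod>i\<in>UNIV. 1 + e i)"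
      using det[of "X + E"] detX P0
      by (simp add: sum det_diag_mat) (metis mult.assoc mult.commute mult_1)
    moreover have "0 < det X"
      using detX P0 by (metis zero_less_mult_pos zero_less_one zero_less_power2)
    ultimately have "ln (det (X + E)) = ln (det X) + (\<Sum>i\<in>UNIV. ln (1 + e i))"
      using e by (simp add: ln_mult_pos prod_pos ln_prod less_imp_neq[THEN not_sym])
    then show ?thesis
      by (simp add: obj_def grad_def inner_add_right inner_diff_left inner sum_subtractf)
  qed
  moreover have "hform X E E = (\<Sum>i\<in>UNIV. (e i)\<^sup>2)"
    by (simp add: h P inner_diag_mat power2_eq_square)
  ultimately show ?thesis using pd that by blast
qed

text \<open>Write \<open>1 + u = r\<^sup>2\<close>. Then \<open>ln (1 + u) = 2 ln r\<close> is at most \<open>2 (r - 1)\<close>, which leaves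
  \<open>(r - 1)\<^sup>2\<close>, that is \<open>u\<^sup>2 / (r + 1)\<^sup>2\<close>.\<close>

lemma diff_ln_lower_bound:
  fixes u R :: real
  assumes "0 < 1 + u" "u \<le> R"
  shows "u\<^sup>2 / (4 + 2 * R) \<le> u - ln (1 + u)"
proof -
  define r where "r = sqrt (1 + u)"
  have r: "r > 0" "1 + u = r\<^sup>2" using assms by (auto simp: r_def)
  have "ln (1 + u) = 2 * ln r" using r by (simp add: ln_realpow)
  also have "\<dots> \<le> 2 * (r - 1)" using ln_le_minus_one[OF r(1)] by simp
  finally have lower: "(r - 1)\<^sup>2 \<le> u - ln (1 + u)" using r by (simp add: power2_eq_square algebra_simps)
  have "u\<^sup>2 = (r - 1)\<^sup>2 * (r + 1)\<^sup>2"
  proof -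
    have "u = (r - 1) * (r + 1)" using r by (simp add: power2_eq_square algebra_simps)
    then show ?thesis by (metis power_mult_distrib)
  qed
  also have "\<dots> \<le> (u - ln (1 + u)) * (4 + 2 * R)"
  proof (intro mult_mono lower)
    show "0 \<le> u - ln (1 + u)" using lower by (rule order_trans[rotated]) simp
    show "(r + 1)\<^sup>2 \<le> 4 + 2 * R"
    proof -
      have "0 \<le> (r - 1)\<^sup>2" by simp
      then show ?thesis using r assms by (simp add: power2_eq_square algebra_simps)
    qed
  qed simp
  finally show ?thesis using assms by (simp add: pos_divide_le_eq)
qed

text \<open>Strong convexity between \<open>X\<close> and \<open>X + E\<close>, measured in the local norm at \<open>X\<close>:
  each relative eigenvalue is at most the local norm of \<open>E\<close>, hence at most \<open>R\<close>.\<close>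

lemma objective_lower_bound:
  fixes X E :: "real^'n^'n"
  assumes X: "pos_def X" and XE: "pos_def (X + E)"
    and R: "0 \<le> R" "hform X E E \<le> R\<^sup>2"
  shows "obj Sig X + grad Sig X \<bullet> E + hform X E E / (4 + 2 * R) \<le> obj Sig (X + E)"
proof -
  have E: "transpose E = E"
    using X XE by (simp add: pos_def_def transpose_add)
  obtain e :: "'n \<Rightarrow> real" where h: "hform X E E = (\<Sum>i\<in>UNIV. (e i)\<^sup>2)" and e: "\<And>i. 0 < 1 + e i"
    and f: "obj Sig (X + E) = obj Sig X + grad Sig X \<bullet> E + (\<Sum>i\<in>UNIV. e i - ln (1 + e i))"
    by (rule objective_expansion[OF X E]) (use XE in simp)
  have "(e i)\<^sup>2 / (4 + 2 * R) \<le> e i - ln (1 + e i)" for i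
  proof (rule diff_ln_lower_bound[OF e])
    have "(e i)\<^sup>2 \<le> hform X E E" unfolding h by (rule member_le_sum) auto
    also note R(2)
    finally show "e i \<le> R" using R(1) by (simp add: power2_le_iff_abs_le)
  qed
  then show ?thesis unfolding f h sum_divide_distrib by (simp add: sum_mono)
qed

lemma objective_gradient_inequality:
  assumes "pos_def X" "pos_def Y"
  shows "obj Sig X + grad Sig X \<bullet> (Y - X) \<le> obj Sig Y"
proof -
  define R where "R = sqrt (hform X (Y - X) (Y - X))"
  have R: "0 \<le> R" "R\<^sup>2 = hform X (Y - X) (Y - X)"
    using hform_nonneg[OF assms(1)] by (simp_all add: R_def)
  have "obj Sig X + grad Sig X \<bullet> (Y - X) + R\<^sup>2 / (4 + 2 * R) \<le> obj Sig Y"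
    using objective_lower_bound[of X "Y - X" R Sig] assms R by simp
  moreover have "0 \<le> R\<^sup>2 / (4 + 2 * R)" using R(1) by simp
  ultimately show ?thesis by linarith
qed

text \<open>Local norm at most \<open>1/2\<close> keeps every relative eigenvalue in \<open>[-1/2, 1/2]\<close>. There \<open>X + E\<close> stays
  positive definite and \<open>u - ln (1 + u)\<close> is at most \<open>2 u\<^sup>2\<close>.\<close>

lemma objective_upper_bound:
  fixes X E :: "real^'n^'n"
  assumes X: "pos_def X" and E: "transpose E = E" and small: "hform X E E \<le> 1 / 4"
  shows "pos_def (X + E)" "obj Sig (X + E) \<le> obj Sig X + grad Sig X \<bullet> E + 2 * hform X E E"
proof -
  obtain e :: "'n \<Rightarrow> real" where h: "hform X E E = (\<Sum>i\<in>UNIV. (e i)\<^sup>2)"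
    and pd: "pos_def (X + E) \<longleftrightarrow> (\<forall>i. 0 < 1 + e i)"
    and f: "pos_def (X + E) \<Longrightarrow>
      obj Sig (X + E) = obj Sig X + grad Sig X \<bullet> E + (\<Sum>i\<in>UNIV. e i - ln (1 + e i))"
    by (rule objective_expansion[OF X E]) simp
  have e: "\<bar>e i\<bar> \<le> 1 / 2" for i
  proof -
    have "(e i)\<^sup>2 \<le> hform X E E" unfolding h by (rule member_le_sum) auto
    also have "\<dots> \<le> (1 / 2)\<^sup>2" using small by (simp add: power2_eq_square)
    finally show ?thesis by (simp add: power2_le_iff_abs_le)
  qed
  have "0 < 1 + e i" for i using e[of i] by linarith
  then show "pos_def (X + E)" by (simp add: pd)
  have "e i - ln (1 + e i) \<le> 2 * (e i)\<^sup>2" for i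
    using abs_ln_one_plus_x_minus_x_bound[OF e[of i]] by linarith
  then show "obj Sig (X + E) \<le> obj Sig X + grad Sig X \<bullet> E + 2 * hform X E E"
    unfolding f[OF \<open>pos_def (X + E)\<close>] h sum_distrib_left by (simp add: sum_mono)
qed

section \<open>The vectorized Hessian\<close>

lemma vec_cols_kronecker:
  "kronecker A B *v vec_cols C = vec_cols (B ** C ** transpose A)"
proof -
  have "(\<Sum>k\<in>UNIV. A $ j $ fst k * B $ i $ snd k * C $ snd k $ fst k)
      = (\<Sum>l\<in>UNIV. (\<Sum>m\<in>UNIV. B $ i $ m * C $ m $ l) * A $ j $ l)" for i j
    unfolding UNIV_Times_UNIV[symmetric] sum.cartesian_product' sum_distrib_right
    by (simp add: mult.commute mult.left_commute)
  then show ?thesis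
    by (simp add: vec_eq_iff kronecker_def vec_cols_def matrix_vector_mult_def
        matrix_matrix_mult_def transpose_def)
qed

lemma inner_vec_cols: "vec_cols A \<bullet> vec_cols B = A \<bullet> B"
  unfolding inner_vec_def vec_cols_def UNIV_Times_UNIV[symmetric] sum.cartesian_product'
  by simp (rule sum.swap)

lemma hess_quadratic_form:
  assumes "pos_def X"
  shows "vec_cols A \<bullet> (hess X *v vec_cols B) = hform X A B"
  by (simp add: hess_def vec_cols_kronecker inner_vec_cols hform_def matrix_inv_pos_def[OF assms])

text \<open>Vectorization is an isometry, so eigenvalue bounds for the Kronecker matrix compare the local
  norm with the Frobenius norm.\<close>

lemma hform_bounds:
  assumes X: "pos_def X" and ev: "\<And>l. eigenvalue (hess X) l \<Longrightarrow> a \<le> l \<and> l \<le> b"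
  shows "a * (norm A)\<^sup>2 \<le> hform X A A" "hform X A A \<le> b * (norm A)\<^sup>2"
proof -
  have entries: "matrix_inv X $ i $ j = matrix_inv X $ j $ i" for i j
    using matrix_inv_pos_def(2)[OF X] by (simp add: transpose_def vec_eq_iff)
  have sym: "transpose (hess X) = hess X"
    by (simp add: transpose_def hess_def kronecker_def) (subst entries, subst (2) entries, rule refl)
  have "norm (vec_cols A) = norm A"
    by (simp add: norm_eq_sqrt_inner inner_vec_cols)
  then show "a * (norm A)\<^sup>2 \<le> hform X A A" "hform X A A \<le> b * (norm A)\<^sup>2"
    using rayleigh_bounds[OF sym ev, where x = "vec_cols A"]
    by (simp_all add: hess_quadratic_form[OF X])
qed

section \<open>The Newton direction\<close>

lemma subspace_Omega: "subspace (Omega S)"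
proof -
  have "Omega S = {X. \<forall>i j. (i, j) \<notin> S \<longrightarrow> X $ i $ j = 0}" by (auto simp: Omega_def)
  then show ?thesis by (simp add: subspace_def)
qed

lemma transpose_in_Omega: "sym S \<Longrightarrow> A \<in> Omega S \<Longrightarrow> transpose A \<in> Omega S"
  by (auto simp: Omega_def transpose_def sym_def)

lemma newton_model_eq:
  assumes "pos_def X" "X \<in> Omega S"
  shows "newton_model Sig S X D =
    (if D \<in> Omega S then ereal (obj Sig X + D \<bullet> grad Sig X + 1/2 * hform X D D) else \<infinity>)"
proof -
  have "X + D \<in> Omega S \<longleftrightarrow> D \<in> Omega S"
    using assms(2) subspace_add[OF subspace_Omega assms(2)]
      subspace_diff[OF subspace_Omega _ assms(2), of "X + D"] by auto
  then show ?thesis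
    by (simp add: newton_model_def hess_quadratic_form[OF assms(1)] pen_def)
qed

text \<open>Outside the ball of radius \<open>2 * norm (grad Sig X) / s\<close> the quadratic term outweighs the linear
  one and the model exceeds its value at \<open>0\<close>. Inside, the model attains its minimum by
  compactness.\<close>

lemma newton_model_minimizer_exists:
  assumes X: "pos_def X" "X \<in> Omega S"
    and s: "0 < s" "\<And>A. s * (norm A)\<^sup>2 \<le> hform X A A"
  shows "\<exists>D. is_arg_min (newton_model Sig S X) (\<lambda>_. True) D"
proof -
  let ?G = "grad Sig X"
  define m where "m D = D \<bullet> ?G + 1/2 * hform X D D" for D
  define r where "r = 2 * norm ?G / s"
  have "0 \<in> Omega S" by (rule subspace_0[OF subspace_Omega])
  moreover have "0 \<le> r" using s by (simp add: r_def)
  ultimately have ne: "Omega S \<inter> cball 0 r \<noteq> {}" by (metis IntI centre_in_cball empty_iff)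
  have cont: "continuous_on (Omega S \<inter> cball 0 r) m"
    unfolding m_def by (intro continuous_intros continuous_on_hform X)
  have "compact (Omega S \<inter> cball 0 r)"
    by (intro closed_Int_compact closed_subspace subspace_Omega compact_cball)
  then obtain D where D: "D \<in> Omega S"
    and min: "\<And>A. A \<in> Omega S \<Longrightarrow> norm A \<le> r \<Longrightarrow> m D \<le> m A"
    using continuous_attains_inf[OF _ ne cont] by auto
  have "m D \<le> m A" if A: "A \<in> Omega S" for A
  proof (cases "norm A \<le> r")
    case True with A show ?thesis by (rule min)
  next
    case False
    have "m D \<le> m 0"
      using \<open>0 \<le> r\<close> by (intro min subspace_0 subspace_Omega) simp
    also have "\<dots> = 0" by (simp add: m_def hform_def)
    also have "0 \<le> norm A * (s * norm A / 2 - norm ?G)"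
      using False s by (intro mult_nonneg_nonneg) (simp_all add: r_def field_simps)
    also have "\<dots> \<le> m A"
      using s(2)[of A] Cauchy_Schwarz_ineq2[of A ?G]
      by (simp add: m_def algebra_simps power2_eq_square)
    finally show ?thesis .
  qed
  then have "is_arg_min (newton_model Sig S X) (\<lambda>_. True) D"
    using D by (auto simp: is_arg_min_def newton_model_eq[OF X] m_def not_less)
  then show ?thesis ..
qed

text \<open>The Newton equation: the direction is the local-inner-product representation of the negative
  gradient on the subspace of admissible matrices.\<close>

lemma newton_dir_characterization:
  assumes X: "pos_def X" "X \<in> Omega S"
    and s: "0 < s" "\<And>A. s * (norm A)\<^sup>2 \<le> hform X A A"
  shows "newton_dir Sig S X \<in> Omega S"
    "E \<in> Omega S \<Longrightarrow> hform X (newton_dir Sig S X) E = - (grad Sig X \<bullet> E)"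
proof -
  define D where "D = newton_dir Sig S X"
  have arg_min: "is_arg_min (newton_model Sig S X) (\<lambda>_. True) D"
    unfolding D_def newton_dir_def arg_min_def
    by (rule someI_ex[OF newton_model_minimizer_exists[OF X s]])
  have "\<not> newton_model Sig S X 0 < newton_model Sig S X D"
    using arg_min by (simp add: is_arg_min_def)
  then show D: "D \<in> Omega S"
    using subspace_0[OF subspace_Omega, of S]
    by (auto simp: newton_model_eq[OF X] split: if_splits)
  assume E: "E \<in> Omega S"
  have "0 \<le> (grad Sig X \<bullet> E + hform X D E) * u + 1/2 * hform X E E * u\<^sup>2" for u
  proof -
    have "D + u *\<^sub>R E \<in> Omega S"
      using D E by (simp add: subspace_Omega subspace_add subspace_scale)
    moreover have "\<not> newton_model Sig S X (D + u *\<^sub>R E) < newton_model Sig S X D"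
      using arg_min by (simp add: is_arg_min_def)
    ultimately show ?thesis
      using D hform_bilinear(5)[OF X(1), of E D]
      by (simp add: newton_model_eq[OF X] hform_bilinear(1-4)[OF X(1)] inner_add_left
          inner_commute[of _ "grad Sig X"] algebra_simps power2_eq_square)
  qed
  then have "grad Sig X \<bullet> E + hform X D E = 0" by (rule linear_coefficient_eq_zero)
  then show "hform X D E = - (grad Sig X \<bullet> E)" by simp
qed

text \<open>The minimization ranges over all matrices, so symmetry has to be proved. The transpose of the
  direction satisfies the same Newton equation, and that equation has only one solution because the
  local form is definite.\<close>

lemma newton_dir_symmetric:
  assumes X: "pos_def X" "X \<in> Omega S"
    and s: "0 < s" "\<And>A. s * (norm A)\<^sup>2 \<le> hform X A A"
    and sym: "transpose Sig = Sig" "sym S"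
  shows "transpose (newton_dir Sig S X) = newton_dir Sig S X"
proof -
  define D where "D = newton_dir Sig S X"
  note D = newton_dir_characterization[OF X s, where Sig = Sig, folded D_def]
  have G: "transpose (grad Sig X) = grad Sig X"
    using sym(1) matrix_inv_pos_def(2)[OF X(1)]
    by (simp add: grad_def transpose_def vec_eq_iff)
  let ?E = "D - transpose D"
  have E: "?E \<in> Omega S" "transpose ?E \<in> Omega S"
    using D(1) sym(2) by (simp_all add: subspace_Omega subspace_diff transpose_in_Omega)
  have "hform X (transpose D) ?E = hform X D (transpose ?E)"
    by (metis hform_transpose X(1) transpose_transpose)
  also have "\<dots> = - (grad Sig X \<bullet> ?E)"
    using D(2)[OF E(2)] inner_transpose[of "grad Sig X" ?E] by (simp add: G)
  also have "\<dots> = hform X D ?E" using D(2)[OF E(1)] by simp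
  finally have "hform X ?E ?E = 0"
    using hform_bilinear(1)[OF X(1), of ?E "transpose D" ?E] by simp
  with s(2)[of ?E] have "s * (norm ?E)\<^sup>2 \<le> 0" by simp
  with s(1) have "?E = 0" by (simp add: mult_le_0_iff)
  then show ?thesis by (simp add: D_def)
qed

section \<open>Line search\<close>

text \<open>Every step of length at most \<open>1 / (4 * (1 + N))\<close> is accepted. Such a step has local length at most
  \<open>1/4\<close>, so the quadratic upper bound applies, and the second-order term \<open>2 a\<^sup>2 q\<close> consumes at
  most half of the first-order decrease \<open>a q\<close>; the other half suffices because \<open>\<omega> < 1/2\<close>.
  Backtracking therefore stops at a length that is at least \<open>\<beta>\<close> times this threshold. The test
  of the line search is satisfied by some power of \<open>\<beta>\<close>, which is what makes its least exponent
  meaningful.\<close>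

lemma step_size_properties:
  assumes X: "pos_def X" and D: "transpose D = D" "grad Sig X \<bullet> D = - hform X D D"
    and N: "0 \<le> N" "hform X D D \<le> N\<^sup>2"
    and \<beta>: "0 < \<beta>" "\<beta> < 1" and \<omega>: "\<omega> < 1/2"
  defines "\<alpha> \<equiv> step_size Sig \<beta> \<omega> X D"
  shows "pos_def (X + \<alpha> *\<^sub>R D)" "obj Sig (X + \<alpha> *\<^sub>R D) \<le> obj Sig X - \<alpha> * \<omega> * hform X D D"
    "\<beta> / (4 * (1 + N)) \<le> \<alpha>"
proof -
  define ok where "ok a \<longleftrightarrow> pos_def (X + a *\<^sub>R D) \<and>
    obj Sig (X + a *\<^sub>R D) \<le> obj Sig X + a * \<omega> * (grad Sig X \<bullet> D)" for a
  define \<tau> where "\<tau> = 1 / (4 * (1 + N))"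
  have \<tau>: "0 < \<tau>" "\<tau> \<le> 1 / 4" "\<tau> * N \<le> 1 / 4"
    using N(1) by (simp_all add: \<tau>_def field_simps)
  let ?q = "hform X D D"
  have q: "0 \<le> ?q" by (rule hform_nonneg[OF X])
  have small_ok: "ok a" if a: "0 \<le> a" "a \<le> \<tau>" for a
  proof -
    have h: "hform X (a *\<^sub>R D) (a *\<^sub>R D) = a\<^sup>2 * ?q"
      by (simp add: hform_bilinear[OF X] power2_eq_square)
    have "a * N \<le> 1 / 4"
      using mult_right_mono[OF a(2) N(1)] \<tau>(3) by linarith
    then have "(a * N)\<^sup>2 \<le> (1 / 4)\<^sup>2" using a N by (intro power_mono) auto
    moreover have "a\<^sup>2 * ?q \<le> (a * N)\<^sup>2"
      using N(2) by (simp add: power_mult_distrib mult_left_mono)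
    ultimately have "hform X (a *\<^sub>R D) (a *\<^sub>R D) \<le> 1 / 4"
      unfolding h by (simp add: power2_eq_square)
    moreover have "transpose (a *\<^sub>R D) = a *\<^sub>R D" by (simp add: D transpose_scalar)
    ultimately have "pos_def (X + a *\<^sub>R D)"
      and f: "obj Sig (X + a *\<^sub>R D) \<le> obj Sig X + grad Sig X \<bullet> (a *\<^sub>R D) + 2 * (a\<^sup>2 * ?q)"
      using objective_upper_bound[OF X, of "a *\<^sub>R D"] by (simp_all flip: h)
    moreover have "2 * (a\<^sup>2 * ?q) \<le> a * ?q * (1 - \<omega>)"
    proof -
      have "2 * (a\<^sup>2 * ?q) = a * ?q * (2 * a)" by (simp add: power2_eq_square)
      also have "\<dots> \<le> a * ?q * (1 - \<omega>)"
        using a q \<tau> \<omega> by (intro mult_left_mono) auto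
      finally show ?thesis .
    qed
    ultimately show ?thesis by (simp add: ok_def D(2) algebra_simps)
  qed
  define m where "m = (LEAST m. ok (\<beta> ^ m))"
  have \<alpha>: "\<alpha> = \<beta> ^ m" by (simp add: \<alpha>_def step_size_def m_def ok_def)
  obtain k where "\<beta> ^ k < \<tau>"
    using real_arch_pow_inv[OF \<tau>(1) \<beta>(2)] by blast
  then have "ok (\<beta> ^ k)" using \<beta> by (intro small_ok) auto
  then have ok: "ok \<alpha>" unfolding \<alpha> m_def by (rule LeastI)
  then show "pos_def (X + \<alpha> *\<^sub>R D)" "obj Sig (X + \<alpha> *\<^sub>R D) \<le> obj Sig X - \<alpha> * \<omega> * ?q"
    by (simp_all add: ok_def D(2))
  show "\<beta> / (4 * (1 + N)) \<le> \<alpha>"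
  proof (cases m)
    case 0
    then have "\<alpha> = 1" by (simp add: \<alpha>)
    moreover have "\<beta> * \<tau> \<le> 1 * 1" using \<beta> \<tau> by (intro mult_mono) auto
    ultimately show ?thesis by (simp add: \<tau>_def)
  next
    case (Suc j)
    (* the last rejected trial step exceeds the threshold *)
    then have "\<not> ok (\<beta> ^ j)" using not_less_Least[of j "\<lambda>m. ok (\<beta> ^ m)"] by (simp add: m_def)
    then have "\<tau> \<le> \<beta> ^ j" using small_ok[of "\<beta> ^ j"] \<beta>(1) by force
    then have "\<beta> * \<tau> \<le> \<beta> ^ m" using \<beta>(1) Suc by simp
    then show ?thesis by (simp add: \<alpha> \<tau>_def)
  qed
qed

text \<open>By the Newton equation the squared decrement is minus the slope of the objective, that is
  \<open>matrix_inv X \<bullet> D - Sig \<bullet> D\<close>. The Cauchy-Schwarz inequality in the local and in the Frobenius inner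
  product bounds this by a constant times the decrement, and one factor cancels.\<close>

lemma newton_decrement_le:
  fixes X :: "real^'n^'n"
  assumes X: "pos_def X" and s: "0 < s" "\<And>A. s * (norm A)\<^sup>2 \<le> hform X A A"
    and D: "grad Sig X \<bullet> D = - hform X D D"
  shows "hform X D D \<le> (norm Sig / sqrt s + sqrt CARD('n))\<^sup>2"
proof -
  let ?q = "hform X D D"
  have "sqrt s * norm D = sqrt (s * (norm D)\<^sup>2)" by (simp add: real_sqrt_mult)
  also have "\<dots> \<le> sqrt ?q" using s(2)[of D] by simp
  finally have D_le: "norm D \<le> sqrt ?q / sqrt s" using s(1) by (simp add: field_simps)
  have "?q = hform X X D - Sig \<bullet> D"
    using D by (simp add: grad_def inner_diff_left hform_self[OF X])
  also have "\<dots> \<le> \<bar>hform X X D\<bar> + \<bar>Sig \<bullet> D\<bar>" by linarith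
  also have "\<dots> \<le> sqrt CARD('n) * sqrt ?q + norm Sig * norm D"
    using hform_Cauchy_Schwarz[OF X, of X D] Cauchy_Schwarz_ineq2[of Sig D]
    by (simp add: hform_self(1)[OF X])
  also have "norm Sig * norm D \<le> norm Sig * (sqrt ?q / sqrt s)"
    using D_le by (intro mult_left_mono) auto
  finally have "?q \<le> (norm Sig / sqrt s + sqrt CARD('n)) * sqrt ?q"
    by (simp add: algebra_simps)
  moreover have "?q = sqrt ?q * sqrt ?q" using hform_nonneg[OF X] by simp
  ultimately have "sqrt ?q * sqrt ?q \<le> (norm Sig / sqrt s + sqrt CARD('n)) * sqrt ?q" by metis
  moreover have "0 \<le> norm Sig / sqrt s + sqrt CARD('n)" using s(1) by simp
  ultimately have "sqrt ?q \<le> norm Sig / sqrt s + sqrt CARD('n)"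
    using hform_nonneg[OF X, of D]
    by (cases "?q = 0") (auto intro: mult_right_le_imp_le[of _ "sqrt ?q"])
  then have "(sqrt ?q)\<^sup>2 \<le> (norm Sig / sqrt s + sqrt CARD('n))\<^sup>2"
    using hform_nonneg[OF X] by (intro power_mono) auto
  then show ?thesis using hform_nonneg[OF X] by simp
qed

section \<open>Convergence\<close>

lemma global_opt_iff:
  assumes "pos_def A" "A \<in> Omega S"
  shows "global_opt Sig S Y \<longleftrightarrow> pos_def Y \<and> Y \<in> Omega S \<and>
    (\<forall>Z. pos_def Z \<and> Z \<in> Omega S \<longrightarrow> obj Sig Y \<le> obj Sig Z)"
  using assms by (auto simp: global_opt_def is_arg_min_def pen_def not_less split: if_splits)

text \<open>Here \<open>\<delta>\<close> is an optimality gap, \<open>q\<close> a decrease measure and \<open>e\<close> an error. If a step lowers the gap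
  by a multiple of \<open>q\<close> and \<open>q\<close> dominates the gap, the gap contracts by a fixed factor; as \<open>q\<close>
  also dominates the squared error and is itself dominated by the gap, the error decays like the
  square root of the gap.\<close>

lemma geometric_decay:
  fixes \<delta> q e :: "nat \<Rightarrow> real"
  assumes pos: "0 < k" "0 < c" "0 < s"
    and \<delta>: "\<And>t. 0 \<le> \<delta> t" "\<And>t. \<delta> (Suc t) \<le> \<delta> t - k * q t"
    and q: "\<And>t. c * \<delta> t \<le> q t" "\<And>t. s * (e t)\<^sup>2 \<le> q t"
  shows "\<exists>C \<rho>. 0 < C \<and> 0 < \<rho> \<and> \<rho> < 1 \<and> (\<forall>t. e t \<le> C * \<rho> ^ t)"
proof -
  (* 1 - k * c may be nonpositive, while the rate has to be positive *)
  define r where "r = max (1 / 2) (1 - k * c)"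
  have r: "0 < r" "r < 1" "1 - k * c \<le> r" using pos by (auto simp: r_def)
  have step: "\<delta> (Suc t) \<le> r * \<delta> t" for t
  proof -
    have "k * (c * \<delta> t) \<le> k * q t" using q(1) pos by (intro mult_left_mono) auto
    then have "\<delta> (Suc t) \<le> (1 - k * c) * \<delta> t" using \<delta>(2)[of t] by (simp add: algebra_simps)
    also have "\<dots> \<le> r * \<delta> t" using r \<delta>(1) by (intro mult_right_mono) auto
    finally show ?thesis .
  qed
  have bound: "\<delta> t \<le> \<delta> 0 * r ^ t" for t
  proof (induction t)
    case (Suc t)
    have "\<delta> (Suc t) \<le> r * \<delta> t" by (rule step)
    also have "\<dots> \<le> r * (\<delta> 0 * r ^ t)" using Suc r by (intro mult_left_mono) auto
    finally show ?case by (simp add: mult_ac)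
  qed simp
  define K where "K = \<delta> 0 / (s * k)"
  have K: "0 \<le> K" using \<delta>(1) pos by (simp add: K_def)
  have "e t \<le> (sqrt K + 1) * sqrt r ^ t" for t
  proof -
    have "k * (s * (e t)\<^sup>2) \<le> k * q t" using q(2) pos by (intro mult_left_mono) auto
    also have "\<dots> \<le> \<delta> t" using \<delta>(1)[of "Suc t"] \<delta>(2)[of t] by simp
    also have "\<dots> \<le> \<delta> 0 * r ^ t" by (rule bound)
    finally have "(e t)\<^sup>2 \<le> K * r ^ t" using pos by (simp add: K_def field_simps)
    then have "e t \<le> sqrt (K * r ^ t)" by (rule real_le_rsqrt)
    also have "\<dots> = sqrt K * sqrt r ^ t" by (simp add: real_sqrt_mult real_sqrt_power)
    also have "\<dots> \<le> (sqrt K + 1) * sqrt r ^ t" using r by (intro mult_right_mono) auto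
    finally show ?thesis .
  qed
  moreover have "0 < sqrt K + 1" using K by (simp add: add_nonneg_pos)
  moreover have "0 < sqrt r" "sqrt r < 1" using r by auto
  ultimately show ?thesis by blast
qed

locale nloa_run =
  fixes Sig :: "real^'n^'n" and S :: "('n \<times> 'n) set"
    and X :: "nat \<Rightarrow> real^'n^'n" and \<beta> \<omega> \<sigma> L :: real
  assumes Sig: "transpose Sig = Sig" and S: "sym S"
    and \<beta>: "0 < \<beta>" "\<beta> < 1" and \<omega>: "0 < \<omega>" "\<omega> < 1/2"
    and run: "NLOA_sequence Sig S \<beta> \<omega> X"
    and \<sigma>: "\<sigma> > 0"
    and spectrum: "\<And>t ev. eigenvalue (hess (X t)) ev \<Longrightarrow> \<sigma> \<le> ev \<and> ev \<le> L"
begin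

definition dir where "dir t = newton_dir Sig S (X t)"

text \<open>The squared Newton decrement.\<close>

definition decr where "decr t = hform (X t) (dir t) (dir t)"

definition decr_bound where "decr_bound = norm Sig / sqrt \<sigma> + sqrt CARD('n)"

text \<open>The guaranteed decrease of the objective per unit of squared Newton decrement: the line search
  parameter times the lower bound for the step size.\<close>

definition \<kappa> where "\<kappa> = \<omega> * (\<beta> / (4 * (1 + decr_bound)))"

lemma decr_bound_nonneg: "0 \<le> decr_bound" using \<sigma> by (simp add: decr_bound_def)

lemma \<kappa>_pos: "0 < \<kappa>" using \<beta> \<omega> decr_bound_nonneg by (simp add: \<kappa>_def)

text \<open>The spectral assumption in the form in which it is used: the local norms at all iterates are
  equivalent to the Frobenius norm with the same two constants.\<close>

lemma hform_iterate:
  assumes "pos_def (X t)"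
  shows "\<sigma> * (norm A)\<^sup>2 \<le> hform (X t) A A" "hform (X t) A A \<le> L * (norm A)\<^sup>2"
  using hform_bounds[OF assms spectrum] by auto

text \<open>One step of the algorithm keeps the iterate feasible and lowers the objective by a fixed multiple
  of the squared Newton decrement. Positive definiteness of the iterate is what makes the bounds of
  the spectral assumption usable, so it is propagated together with the descent.\<close>

lemma iteration:
  assumes "pos_def (X t)" "X t \<in> Omega S"
  shows "dir t \<in> Omega S" "\<And>E. E \<in> Omega S \<Longrightarrow> hform (X t) (dir t) E = - (grad Sig (X t) \<bullet> E)"
    "pos_def (X (Suc t))" "X (Suc t) \<in> Omega S"
    "obj Sig (X (Suc t)) \<le> obj Sig (X t) - \<kappa> * decr t"
proof -
  note lower = hform_iterate(1)[OF assms(1)]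
  show dir: "dir t \<in> Omega S"
    and newton: "\<And>E. E \<in> Omega S \<Longrightarrow> hform (X t) (dir t) E = - (grad Sig (X t) \<bullet> E)"
    unfolding dir_def using newton_dir_characterization[OF assms \<sigma> lower] by auto
  have G: "grad Sig (X t) \<bullet> dir t = - decr t" using newton[OF dir] by (simp add: decr_def)
  have q_le: "decr t \<le> decr_bound\<^sup>2"
    unfolding decr_def decr_bound_def using G by (intro newton_decrement_le assms \<sigma> lower) (simp add: decr_def)
  define \<alpha> where "\<alpha> = step_size Sig \<beta> \<omega> (X t) (dir t)"
  have X_Suc: "X (Suc t) = X t + \<alpha> *\<^sub>R dir t"
    using run by (simp add: NLOA_sequence_def \<alpha>_def dir_def)
  have "transpose (dir t) = dir t"
    unfolding dir_def by (rule newton_dir_symmetric[OF assms \<sigma> lower Sig S])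
  then have step: "pos_def (X t + \<alpha> *\<^sub>R dir t)"
    "obj Sig (X t + \<alpha> *\<^sub>R dir t) \<le> obj Sig (X t) - \<alpha> * \<omega> * decr t" "\<beta> / (4 * (1 + decr_bound)) \<le> \<alpha>"
    using step_size_properties[OF assms(1), of "dir t" Sig decr_bound \<beta> \<omega>] G q_le decr_bound_nonneg \<beta> \<omega>
    by (simp_all add: \<alpha>_def decr_def)
  show "pos_def (X (Suc t))" using step(1) by (simp add: X_Suc)
  show "X (Suc t) \<in> Omega S"
    unfolding X_Suc using assms(2) dir by (simp add: subspace_Omega subspace_add subspace_scale)
  have "\<kappa> * decr t \<le> \<alpha> * \<omega> * decr t"
  proof (rule mult_right_mono)
    show "\<kappa> \<le> \<alpha> * \<omega>" using mult_left_mono[OF step(3), of \<omega>] \<omega> by (simp add: \<kappa>_def mult.commute)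
    show "0 \<le> decr t" unfolding decr_def by (rule hform_nonneg[OF assms(1)])
  qed
  with step(2) show "obj Sig (X (Suc t)) \<le> obj Sig (X t) - \<kappa> * decr t" by (simp add: X_Suc)
qed

lemma feasible: "pos_def (X t)" "X t \<in> Omega S"
proof -
  have "pos_def (X t) \<and> X t \<in> Omega S"
    using run iteration(3,4) by (induction t) (auto simp: NLOA_sequence_def)
  then show "pos_def (X t)" "X t \<in> Omega S" by auto
qed

lemmas optimal_iff = global_opt_iff[OF feasible, where Sig = Sig]
lemmas hform_lower = hform_iterate(1)[OF feasible(1)]
lemmas hform_upper = hform_iterate(2)[OF feasible(1)]
lemmas newton_equation = iteration(2)[OF feasible]
lemmas descent = iteration(5)[OF feasible]

lemma decr_nonneg: "0 \<le> decr t"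
  unfolding decr_def by (rule hform_nonneg[OF feasible(1)])

lemma L_nonneg: "0 \<le> L"
proof -
  have "\<sigma> * (norm (mat 1 :: real^'n^'n))\<^sup>2 \<le> L * (norm (mat 1 :: real^'n^'n))\<^sup>2"
    using hform_lower hform_upper by (rule order_trans)
  moreover have "(mat 1 :: real^'n^'n) \<noteq> 0"
    by (simp add: mat_def vec_eq_iff)
  ultimately show ?thesis using \<sigma> by simp
qed

text \<open>The local squared length of \<open>X t\<close> at \<open>X t\<close> is the dimension, so the lower spectral bound confines
  all iterates to a ball.\<close>

lemma iterate_norm_le: "norm (X t) \<le> sqrt (CARD('n) / \<sigma>)"
proof (rule real_le_rsqrt)
  show "(norm (X t))\<^sup>2 \<le> CARD('n) / \<sigma>"
    using hform_lower[of "X t" t] \<sigma> by (simp add: hform_self(1)[OF feasible(1)] field_simps)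
qed

lemma sqrt_hform_le: "sqrt (hform (X t) E E) \<le> sqrt L * norm E"
  using real_sqrt_le_mono[OF hform_upper[of t E]] by (simp add: real_sqrt_mult)

text \<open>On admissible directions the gradient is represented by the Newton direction, hence it is as small
  as the Newton decrement.\<close>

lemma feasible_gradient_le:
  assumes "E \<in> Omega S"
  shows "\<bar>grad Sig (X t) \<bullet> E\<bar> \<le> sqrt (decr t) * sqrt (hform (X t) E E)"
  using hform_Cauchy_Schwarz[OF feasible(1), of t "dir t" E] newton_equation[OF assms, of t]
  by (simp add: decr_def)

text \<open>Let \<open>h\<close> be the local length of the step from \<open>X t\<close> to \<open>Y\<close>. Strong convexity and the preceding
  gradient estimate give \<open>c h\<^sup>2 + gap \<le> sqrt (decr t) h\<close>. Both terms on the left are nonnegative.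
  The first one yields \<open>c h \<le> sqrt (decr t)\<close>; inserting this on the right bounds the gap. Thus the
  squared decrement dominates both the gap and the squared distance to \<open>Y\<close>.\<close>

lemma error_bound:
  assumes Y: "pos_def Y" "Y \<in> Omega S" and better: "\<And>t. obj Sig Y \<le> obj Sig (X t)"
  obtains c where "0 < c" "\<And>t. c * (obj Sig (X t) - obj Sig Y) \<le> decr t"
    "\<And>t. \<sigma> * c\<^sup>2 * (norm (X t - Y))\<^sup>2 \<le> decr t"
proof -
  define R where "R = sqrt L * (norm Y + sqrt (CARD('n) / \<sigma>))"
  have R: "0 \<le> R" using L_nonneg \<sigma> by (simp add: R_def)
  define c where "c = 1 / (4 + 2 * R)"
  have c: "0 < c" using R by (simp add: c_def)
  have "c * (obj Sig (X t) - obj Sig Y) \<le> decr t \<and> \<sigma> * c\<^sup>2 * (norm (X t - Y))\<^sup>2 \<le> decr t" for t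
  proof -
    define E where "E = Y - X t"
    define h where "h = sqrt (hform (X t) E E)"
    have h: "0 \<le> h" "h\<^sup>2 = hform (X t) E E"
      using hform_nonneg[OF feasible(1), of t E] by (simp_all add: h_def)
    have E: "E \<in> Omega S" using Y feasible(2) by (simp add: E_def subspace_Omega subspace_diff)
    have "norm E \<le> norm Y + sqrt (CARD('n) / \<sigma>)"
      using norm_triangle_ineq4[of Y "X t"] iterate_norm_le[of t] by (simp add: E_def)
    then have "h \<le> R"
      unfolding R_def h_def
      by (intro order_trans[OF sqrt_hform_le] mult_left_mono) (simp_all add: L_nonneg)
    then have "hform (X t) E E \<le> R\<^sup>2" using h by (metis power_mono)
    then have "obj Sig (X t) + grad Sig (X t) \<bullet> E + h\<^sup>2 * c \<le> obj Sig Y"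
      using objective_lower_bound[OF feasible(1), of t E R Sig] Y R by (simp add: E_def h c_def)
    moreover have "- (grad Sig (X t) \<bullet> E) \<le> sqrt (decr t) * h"
      using feasible_gradient_le[OF E, of t] by (simp add: h_def)
    ultimately have key: "c * h\<^sup>2 + (obj Sig (X t) - obj Sig Y) \<le> sqrt (decr t) * h"
      by (simp add: mult.commute)
    then have "(c * h) * h \<le> sqrt (decr t) * h"
      using better[of t] by (simp add: power2_eq_square mult.assoc)
    then have ch: "c * h \<le> sqrt (decr t)"
      using h(1) decr_nonneg[of t] by (cases "h = 0") (auto intro: mult_right_le_imp_le[of _ h])
    have "obj Sig (X t) - obj Sig Y \<le> sqrt (decr t) * h"
      using key c by (smt (verit) mult_nonneg_nonneg zero_le_power2)
    then have "c * (obj Sig (X t) - obj Sig Y) \<le> c * (sqrt (decr t) * h)"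
      using c by (intro mult_left_mono) auto
    also have "\<dots> = sqrt (decr t) * (c * h)" by simp
    also have "\<dots> \<le> sqrt (decr t) * sqrt (decr t)" using ch decr_nonneg by (intro mult_left_mono) auto
    also have "\<dots> = decr t" using decr_nonneg by simp
    finally have gap: "c * (obj Sig (X t) - obj Sig Y) \<le> decr t" .
    have "\<sigma> * c\<^sup>2 * (norm E)\<^sup>2 = c\<^sup>2 * (\<sigma> * (norm E)\<^sup>2)" by simp
    also have "\<dots> \<le> c\<^sup>2 * h\<^sup>2" unfolding h(2) by (intro mult_left_mono hform_lower) simp
    also have "\<dots> = (c * h)\<^sup>2" by (simp add: power_mult_distrib)
    also have "\<dots> \<le> (sqrt (decr t))\<^sup>2" using ch c h by (intro power_mono) auto
    also have "\<dots> = decr t" using decr_nonneg by simp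
    finally show ?thesis using gap by (simp add: E_def norm_minus_commute)
  qed
  with c show ?thesis using that by blast
qed

lemma linear_convergence:
  assumes "global_opt Sig S Y"
  shows "\<exists>C \<rho>. 0 < C \<and> 0 < \<rho> \<and> \<rho> < 1 \<and> (\<forall>t. norm (X t - Y) \<le> C * \<rho> ^ t)"
proof -
  have Y: "pos_def Y" "Y \<in> Omega S" "\<And>t. obj Sig Y \<le> obj Sig (X t)"
    using assms feasible unfolding optimal_iff by auto
  then obtain c where c: "0 < c" "\<And>t. c * (obj Sig (X t) - obj Sig Y) \<le> decr t"
    "\<And>t. \<sigma> * c\<^sup>2 * (norm (X t - Y))\<^sup>2 \<le> decr t"
    using error_bound by blast
  show ?thesis
  proof (rule geometric_decay[where k = \<kappa> and c = c and s = "\<sigma> * c\<^sup>2"])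
    show "0 < \<kappa>" by (rule \<kappa>_pos)
    show "0 < \<sigma> * c\<^sup>2" using \<sigma> c(1) by simp
    show "0 \<le> obj Sig (X t) - obj Sig Y" for t using Y(3) by simp
    show "obj Sig (X (Suc t)) - obj Sig Y \<le> obj Sig (X t) - obj Sig Y - \<kappa> * decr t" for t
      using descent by simp
  qed (use c in auto)
qed

lemma objective_bounded_below: "\<exists>b. \<forall>t. b \<le> obj Sig (X t)"
proof -
  define M where "M = sqrt (CARD('n) / \<sigma>)"
  have "obj Sig (X 0) - norm (grad Sig (X 0)) * (M + M) \<le> obj Sig (X t)" for t
  proof -
    have "norm (X t - X 0) \<le> M + M"
      using norm_triangle_ineq4[of "X t" "X 0"] iterate_norm_le[of t] iterate_norm_le[of 0]
      by (simp add: M_def)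
    then have "norm (grad Sig (X 0)) * norm (X t - X 0) \<le> norm (grad Sig (X 0)) * (M + M)"
      by (intro mult_left_mono) auto
    then show ?thesis
      using objective_gradient_inequality[OF feasible(1)[of 0] feasible(1)[of t], of Sig]
        Cauchy_Schwarz_ineq2[of "grad Sig (X 0)" "X t - X 0"] by linarith
  qed
  then show ?thesis by blast
qed

text \<open>The objective values decrease and are bounded below, so consecutive differences, and with them the
  Newton decrements, tend to zero.\<close>

lemma objective_limit:
  obtains l where "(\<lambda>t. obj Sig (X t)) \<longlonglongrightarrow> l" "decr \<longlonglongrightarrow> 0"
proof -
  obtain b where "\<And>t. b \<le> obj Sig (X t)" using objective_bounded_below by blast
  moreover have "decseq (\<lambda>t. obj Sig (X t))"
  proof (rule decseq_SucI)
    show "obj Sig (X (Suc t)) \<le> obj Sig (X t)" for t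
      using descent[of t] mult_nonneg_nonneg[of \<kappa> "decr t"] \<kappa>_pos decr_nonneg[of t] by linarith
  qed
  ultimately obtain l where l: "(\<lambda>t. obj Sig (X t)) \<longlonglongrightarrow> l"
    using decseq_convergent by metis
  have "(\<lambda>t. (obj Sig (X t) - obj Sig (X (Suc t))) / \<kappa>) \<longlonglongrightarrow> (l - l) / \<kappa>"
    using l LIMSEQ_Suc[OF l] \<kappa>_pos by (intro tendsto_intros) auto
  then have "(\<lambda>t. (obj Sig (X t) - obj Sig (X (Suc t))) / \<kappa>) \<longlonglongrightarrow> 0" by simp
  then have "decr \<longlonglongrightarrow> 0"
  proof (rule tendsto_sandwich[OF always_eventually always_eventually tendsto_const, rotated 2])
    show "\<forall>t. decr t \<le> (obj Sig (X t) - obj Sig (X (Suc t))) / \<kappa>"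
      using descent \<kappa>_pos by (simp add: pos_le_divide_eq algebra_simps)
  qed (use decr_nonneg in simp)
  with l that show ?thesis by blast
qed

text \<open>A cluster point \<open>Y\<close> of the bounded sequence of iterates is optimal. Expanding the objective at a
  nearby iterate \<open>X (r k)\<close> shows that \<open>Y\<close> is positive definite and that its value is at most the
  limit \<open>l\<close> of the objective values. Conversely, the gradient inequality at the iterates, in which
  the gradient term vanishes in the limit, shows that no feasible matrix has a value below \<open>l\<close>.\<close>

lemma optimum_exists: "\<exists>Y. global_opt Sig S Y"
proof -
  obtain l where l: "(\<lambda>t. obj Sig (X t)) \<longlonglongrightarrow> l" and q0: "decr \<longlonglongrightarrow> 0"
    by (rule objective_limit)
  have "\<forall>t. X t \<in> cball 0 (sqrt (CARD('n) / \<sigma>))" using iterate_norm_le by simp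
  then obtain Y r where r: "strict_mono r" and XY: "(X \<circ> r) \<longlonglongrightarrow> Y"
    using compact_cball[of "0 :: real^'n^'n"] unfolding compact_def by metis
  define E where "E k = Y - X (r k)" for k
  have E: "E \<longlonglongrightarrow> 0"
    unfolding E_def using tendsto_diff[OF tendsto_const XY, of Y] by (simp add: o_def)
  have lr: "(\<lambda>k. obj Sig (X (r k))) \<longlonglongrightarrow> l" and qr: "(\<lambda>k. decr (r k)) \<longlonglongrightarrow> 0"
    using LIMSEQ_subseq_LIMSEQ[OF l r] LIMSEQ_subseq_LIMSEQ[OF q0 r] by (simp_all add: o_def)
  have "closed (Omega S)" by (intro closed_subspace subspace_Omega)
  then have Y: "Y \<in> Omega S"
    using closed_sequentially[OF _ _ XY] feasible(2) by auto
  have "subspace {A :: real^'n^'n. transpose A = A}"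
    by (auto simp: subspace_def transpose_add transpose_scalar) (simp add: transpose_def vec_eq_iff)
  then have "closed {A :: real^'n^'n. transpose A = A}" by (rule closed_subspace)
  then have symY: "transpose Y = Y"
    using closed_sequentially[OF _ _ XY] feasible(1) by (auto simp: pos_def_def)
  have sym: "transpose (E k) = E k" for k
    using symY feasible(1)[of "r k"] by (simp add: E_def pos_def_def transpose_def vec_eq_iff)
  have small: "(\<lambda>k. L * (norm (E k))\<^sup>2) \<longlonglongrightarrow> 0"
    using tendsto_mult[OF tendsto_const tendsto_power[OF tendsto_norm[OF E], of 2], of L] by simp
  then have "\<forall>\<^sub>F k in sequentially. L * (norm (E k))\<^sup>2 < 1 / 4"
    by (rule order_tendstoD) simp
  then have upper: "\<forall>\<^sub>F k in sequentially. pos_def Y \<and> obj Sig Y \<le>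
    obj Sig (X (r k)) + sqrt (decr (r k)) * (sqrt L * norm (E k)) + 2 * (L * (norm (E k))\<^sup>2)"
  proof eventually_elim
    case (elim k)
    have hE: "hform (X (r k)) (E k) (E k) \<le> L * (norm (E k))\<^sup>2" by (rule hform_upper)
    then have h: "hform (X (r k)) (E k) (E k) \<le> 1 / 4" using elim by simp
    have "E k \<in> Omega S" using Y feasible(2) by (simp add: E_def subspace_Omega subspace_diff)
    then have "grad Sig (X (r k)) \<bullet> E k \<le> sqrt (decr (r k)) * (sqrt L * norm (E k))"
      using feasible_gradient_le[of "E k" "r k"]
        mult_left_mono[OF sqrt_hform_le[of "r k" "E k"], of "sqrt (decr (r k))"] decr_nonneg[of "r k"]
      by simp
    moreover have "X (r k) + E k = Y" by (simp add: E_def)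
    ultimately show ?case
      using objective_upper_bound(1)[OF feasible(1) sym h] hE
        objective_upper_bound(2)[OF feasible(1) sym h, of Sig] by simp
  qed
  then have pdY: "pos_def Y" using eventually_happens[OF upper] by simp
  have sq: "(\<lambda>k. sqrt (decr (r k))) \<longlonglongrightarrow> 0" using tendsto_real_sqrt[OF qr] by simp
  have "(\<lambda>k. obj Sig (X (r k)) + sqrt (decr (r k)) * (sqrt L * norm (E k)) + 2 * (L * (norm (E k))\<^sup>2))
      \<longlonglongrightarrow> l + 0 * (sqrt L * norm (0 :: real^'n^'n)) + 2 * 0"
    by (intro tendsto_intros lr sq E small)
  then have "obj Sig Y \<le> l + 0 * (sqrt L * norm (0 :: real^'n^'n)) + 2 * 0"
    by (rule tendsto_lowerbound) (use upper in \<open>auto elim: eventually_mono\<close>)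
  then have "obj Sig Y \<le> l" by simp
  moreover have "l \<le> obj Sig Z" if Z: "pos_def Z" "Z \<in> Omega S" for Z
  proof -
    have "(\<lambda>k. obj Sig (X (r k)) - sqrt (decr (r k)) * (sqrt L * norm (Z - X (r k))))
        \<longlonglongrightarrow> l - 0 * (sqrt L * norm (Z - Y))"
      using XY by (intro tendsto_intros lr sq) (simp add: o_def)
    then have lim: "(\<lambda>k. obj Sig (X (r k)) - sqrt (decr (r k)) * (sqrt L * norm (Z - X (r k)))) \<longlonglongrightarrow> l"
      by simp
    have "obj Sig (X t) - sqrt (decr t) * (sqrt L * norm (Z - X t)) \<le> obj Sig Z" for t
    proof -
      have "Z - X t \<in> Omega S" using Z feasible(2) by (simp add: subspace_Omega subspace_diff)
      then have "- (grad Sig (X t) \<bullet> (Z - X t)) \<le> sqrt (decr t) * (sqrt L * norm (Z - X t))"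
        using feasible_gradient_le[of "Z - X t" t]
          mult_left_mono[OF sqrt_hform_le[of t "Z - X t"], of "sqrt (decr t)"] decr_nonneg[of t]
        by simp
      then show ?thesis
        using objective_gradient_inequality[OF feasible(1)[of t] Z(1), of Sig] by linarith
    qed
    then show ?thesis using LIMSEQ_le_const2[OF lim] by blast
  qed
  ultimately show ?thesis
    using pdY Y unfolding optimal_iff by (meson order_trans)
qed

end

theorem theorem2:
  fixes Sig :: "real^'n^'n" and S :: "('n \<times> 'n) set"
    and X :: "nat \<Rightarrow> real^'n^'n" and \<beta> \<omega> \<sigma> L :: real
  assumes "transpose Sig = Sig" and "sym S"
    and "0 < \<beta>" and "\<beta> < 1" and "0 < \<omega>" and "\<omega> < 1/2"
    and "NLOA_sequence Sig S \<beta> \<omega> X"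
    and "\<sigma> > 0"
    and "\<And>t ev. eigenvalue (hess (X t)) ev \<Longrightarrow> \<sigma> \<le> ev \<and> ev \<le> L"
  shows "(\<exists>!Xstar. global_opt Sig S Xstar) \<and>
    (\<forall>Xstar. global_opt Sig S Xstar \<longrightarrow>
      (\<exists>C \<rho>. C > 0 \<and> 0 < \<rho> \<and> \<rho> < 1 \<and> (\<forall>t. norm (X t - Xstar) \<le> C * \<rho> ^ t)))"
proof -
  interpret nloa_run Sig S X \<beta> \<omega> \<sigma> L
    using assms by unfold_locales auto
  have limit: "X \<longlonglongrightarrow> Y" if Y: "global_opt Sig S Y" for Y
  proof -
    obtain C \<rho> where \<rho>: "0 < \<rho>" "\<rho> < 1" and le: "\<And>t. norm (X t - Y) \<le> C * \<rho> ^ t"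
      using linear_convergence[OF Y] by blast
    have "(\<lambda>t. \<rho> ^ t) \<longlonglongrightarrow> 0" using \<rho> by (intro LIMSEQ_power_zero) simp
    then have "(\<lambda>t. C * \<rho> ^ t) \<longlonglongrightarrow> 0" by (rule tendsto_mult_right_zero)
    then have "(\<lambda>t. X t - Y) \<longlonglongrightarrow> 0"
      by (rule Lim_null_comparison[OF always_eventually, rotated]) (intro allI le)
    then show ?thesis by (simp add: LIM_zero_iff)
  qed
  (* two optima would both be limits of the same sequence *)
  have "\<exists>!Y. global_opt Sig S Y"
    using optimum_exists LIMSEQ_unique[OF limit limit] by blast
  then show ?thesis using linear_convergence by blast
qed

end
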